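(* Let $E \subset \mathbb{R}^n$ be an arbitrary subset, let $f: E \to \mathbb{R}$ be a function and let $G: E \rightrightarrows \mathbb{R}^n$ be a set-valued mapping such that $G(x)$ is compact, convex and nonempty for every $x\in E$. There exists a convex function $F: \mathbb{R}^n \to \mathbb{R}$ such that $F(x)=f(x)$ and $\partial F(x)= G(x)$ for every $x\in E$ if and only if the following three conditions are all satisfied. $(C)$: $f(x) \geq f(y)+ \langle y^*,x-y \rangle$ for every $x,y\in E$ and every $y^*\in G(y)$. $(EX)$: If $(y_k)_k \subset E$ and $(y_k^* )_k \subset \mathbb{R}^n$ are sequences such that $y_k^* \in G(y_k)$ for every $k$ and $\lim_k |y_k^*| =+\infty$, then $$\lim_k \frac{\langle y_k,y_k^*\rangle-f(y_k)}{|y_k^*|}= +\infty.$$ $(SCS)$: If $x\in E$ and $(y_k)_k \subset E$, $(y_k^* )_k \subset \mathbb{R}^n$ are sequences such that $y_k^* \in G(y_k)$ for every $k$, $(y_k^* )_k$ is bounded, and $$\lim_k \left( f(x)-f(y_k)-\langle y_k^*, x-y_k \rangle \right)=0,$$ then there exists a sequence $(x_k^* )_k \subset G(x)$ such that $\lim_k |x_k^*-y_k^*|=0$.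
   Context: $\langle\cdot,\cdot\rangle$ and $|\cdot|$ are the Euclidean inner product and norm on $\mathbb{R}^n$. A set-valued mapping $G: E \rightrightarrows \mathbb{R}^n$ assigns to each $x\in E$ a subset $G(x)\subset\mathbb{R}^n$. For a convex function $F:\mathbb{R}^n\to\mathbb{R}$, the subdifferential at $x$ is $\partial F(x)=\{\xi\in\mathbb{R}^n : F(z)\ge F(x)+\langle \xi, z-x\rangle \text{ for all } z\in\mathbb{R}^n\}$. *)

theory Defs
  imports "HOL-Analysis.Analysis"
begin

definition subdifferential :: "('a::real_inner \<Rightarrow> real) \<Rightarrow> 'a \<Rightarrow> 'a set"
  where "subdifferential F x = {\<xi>. \<forall>z. F z \<ge> F x + \<xi> \<bullet> (z - x)}"

end

theory Submission
  imports Defs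
begin

text \<open>
  Sufficiency: the smallest candidate \<open>m z = sup {f y + y' \<bullet> (z - y) | y \<in> E, y' \<in> G y}\<close> already
  works. Condition (EX) says that steep minorants lie far below, so the supremum is finite and
  near-optimal slopes over a bounded set are bounded; (C) gives \<open>m = f\<close> on \<open>E\<close> and
  \<open>G x \<subseteq> \<partial>m x\<close>. If some \<open>\<xi> \<in> \<partial>m x\<close> were outside \<open>G x\<close>, separate it from \<open>G x\<close> by a direction
  \<open>v\<close>; slopes that are nearly optimal at \<open>x + t v\<close> with \<open>t \<rightarrow> 0\<close> are bounded, nearly active at \<open>x\<close>, and
  stay away from \<open>G x\<close>, against (SCS).

  Necessity: (EX) holds because a finite convex function is bounded on balls, so that its conjugate is
  superlinear, and (SCS) because cluster points of approximate subgradients at \<open>x\<close> are subgradients.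
\<close>

section \<open>Necessity: subgradients of a finite convex function\<close>

text \<open>\<open>y k \<bullet> y' k - F (y k)\<close> is the conjugate of \<open>F\<close> at
  \<open>y' k\<close>. Testing the subgradient inequality at the point of norm \<open>r\<close> in
  direction \<open>y' k\<close> bounds it below by \<open>r * norm (y' k)\<close> minus a bound for
  \<open>F\<close> on a ball; \<open>r\<close> is arbitrary. This gives (EX).\<close>

lemma conjugate_superlinear_along_subgradients:
  fixes F :: "'a::euclidean_space \<Rightarrow> real"
  assumes F: "convex_on UNIV F"
    and sub: "\<And>k. y' k \<in> subdifferential F (y k)"
    and lim: "filterlim (\<lambda>k. norm (y' k)) at_top L"
  shows "filterlim (\<lambda>k. (y k \<bullet> y' k - F (y k)) / norm (y' k)) at_top L"
  unfolding filterlim_at_top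
proof
  fix Z :: real
  \<comment> \<open>The extra 1 contributes \<open>norm (y' k)\<close>, which eventually absorbs the
    bound \<open>C\<close> of \<open>F\<close> on the ball and leaves the factor
    \<open>\<bar>Z\<bar>\<close>.\<close>
  define r where "r = \<bar>Z\<bar> + 1"
  have "continuous_on UNIV F"
    using convex_on_continuous[OF open_UNIV F] .
  then have "compact (F ` cball 0 r)"
    by (meson compact_cball compact_continuous_image continuous_on_subset subset_UNIV)
  then obtain C where "C > 0" "\<forall>w\<in>F ` cball 0 r. norm w \<le> C"
    using compact_imp_bounded bounded_pos by blast
  then have C: "C > 0" "\<And>z. norm z \<le> r \<Longrightarrow> F z \<le> C"
    by (auto intro: abs_le_D1)
  have "\<forall>\<^sub>F k in L. C \<le> norm (y' k)"
    using lim unfolding filterlim_at_top by blast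
  then show "\<forall>\<^sub>F k in L. Z \<le> (y k \<bullet> y' k - F (y k)) / norm (y' k)"
  proof eventually_elim
    case (elim k)
    define n where "n = norm (y' k)"
    have n: "n > 0" "C \<le> n" using elim C n_def by auto
    define z where "z = (r / n) *\<^sub>R y' k"
    have "norm z \<le> r" using n by (simp add: z_def n_def r_def)
    then have "F z \<le> C" by (rule C)
    moreover have "F z \<ge> F (y k) + y' k \<bullet> (z - y k)"
      using sub[of k] by (simp add: subdifferential_def)
    moreover have "y' k \<bullet> z = r * n"
      using n by (simp add: z_def n_def power2_norm_eq_inner[symmetric] power2_eq_square)
    ultimately have "r * n - C \<le> y k \<bullet> y' k - F (y k)"
      by (simp add: inner_diff_right inner_commute)
    moreover have "Z * n \<le> r * n - C"
    proof -
      have "Z * n \<le> \<bar>Z\<bar> * n" using n by (intro mult_right_mono) auto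
      moreover have "r * n = \<bar>Z\<bar> * n + n" by (simp add: r_def distrib_right)
      ultimately show ?thesis using n by linarith
    qed
    ultimately show ?case using n by (simp add: n_def pos_le_divide_eq)
  qed
qed

text \<open>A subsequence staying at distance at least \<open>r\<close> from the subdifferential
  would, by boundedness, have a cluster point \<open>l\<close>; letting \<open>e\<close> tend to 0
  in the inequality makes \<open>l\<close> a subgradient. This gives (SCS).\<close>

lemma approximate_subgradients_near_subdifferential:
  fixes F :: "'a::euclidean_space \<Rightarrow> real"
  assumes bdd: "bounded (range y')"
    and approx: "\<And>k z. F z \<ge> F x + y' k \<bullet> (z - x) - e k"
    and e: "e \<longlonglongrightarrow> 0"
  shows "(\<lambda>k. infdist (y' k) (subdifferential F x)) \<longlonglongrightarrow> 0"
proof (rule ccontr)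
  let ?d = "\<lambda>w. infdist w (subdifferential F x)"
  assume "\<not> ?thesis"
  then obtain r where r: "r > 0" and freq: "\<And>N. \<exists>k\<ge>N. r \<le> ?d (y' k)"
    by (auto simp: LIMSEQ_def dist_real_def infdist_nonneg not_less)
  have "infinite {k. r \<le> ?d (y' k)}"
    unfolding infinite_nat_iff_unbounded_le using freq by blast
  then obtain s :: "nat \<Rightarrow> nat" where s: "strict_mono s" "\<And>k. r \<le> ?d (y' (s k))"
    using infinite_enumerate by blast
  have "bounded (range (y' \<circ> s))"
    using bdd by (rule bounded_subset) auto
  then obtain l t where t: "strict_mono t" "((y' \<circ> s) \<circ> t) \<longlonglongrightarrow> l"
    using bounded_imp_convergent_subsequence by blast
  have "strict_mono (s \<circ> t)" using s t strict_mono_o by blast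
  then have e': "(\<lambda>k. e ((s \<circ> t) k)) \<longlonglongrightarrow> 0"
    using LIMSEQ_subseq_LIMSEQ[OF e] by (simp add: o_def)
  have y: "(\<lambda>k. y' ((s \<circ> t) k)) \<longlonglongrightarrow> l" using t by (simp add: o_def)
  have "F z \<ge> F x + l \<bullet> (z - x)" for z
  proof -
    have "(\<lambda>k. F x + y' ((s \<circ> t) k) \<bullet> (z - x) - e ((s \<circ> t) k)) \<longlonglongrightarrow> F x + l \<bullet> (z - x) - 0"
      by (intro tendsto_intros y e')
    then have "F x + l \<bullet> (z - x) - 0 \<le> F z"
      by (rule LIMSEQ_le_const2) (use approx in blast)
    then show ?thesis by simp
  qed
  then have "l \<in> subdifferential F x" by (simp add: subdifferential_def)
  then have "?d l = 0" by simp
  moreover have "(\<lambda>k. ?d (y' ((s \<circ> t) k))) \<longlonglongrightarrow> ?d l"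
    by (intro tendsto_infdist y)
  then have "r \<le> ?d l"
    by (rule LIMSEQ_le_const) (use s in auto)
  ultimately show False using r by simp
qed

section \<open>Sufficiency: the supremum of the prescribed affine minorants\<close>

lemma convex_on_SUP_affine:
  fixes a :: "'i \<Rightarrow> real" and b :: "'i \<Rightarrow> 'a::real_inner"
  assumes "A \<noteq> {}" and bdd: "\<And>z. bdd_above ((\<lambda>i. a i + b i \<bullet> z) ` A)"
  shows "convex_on UNIV (\<lambda>z. SUP i\<in>A. a i + b i \<bullet> z)"
proof (rule convex_onI)
  fix t :: real and x y :: 'a
  assume t: "0 < t" "t < 1"
  show "(SUP i\<in>A. a i + b i \<bullet> ((1 - t) *\<^sub>R x + t *\<^sub>R y))
      \<le> (1 - t) * (SUP i\<in>A. a i + b i \<bullet> x) + t * (SUP i\<in>A. a i + b i \<bullet> y)"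
  proof (rule cSUP_least)
    fix i assume "i \<in> A"
    then have "a i + b i \<bullet> x \<le> (SUP i\<in>A. a i + b i \<bullet> x)" "a i + b i \<bullet> y \<le> (SUP i\<in>A. a i + b i \<bullet> y)"
      using bdd by (auto intro: cSUP_upper2)
    then have "(1 - t) * (a i + b i \<bullet> x) + t * (a i + b i \<bullet> y)
      \<le> (1 - t) * (SUP i\<in>A. a i + b i \<bullet> x) + t * (SUP i\<in>A. a i + b i \<bullet> y)"
      using t by (intro add_mono mult_left_mono) auto
    then show "a i + b i \<bullet> ((1 - t) *\<^sub>R x + t *\<^sub>R y)
      \<le> (1 - t) * (SUP i\<in>A. a i + b i \<bullet> x) + t * (SUP i\<in>A. a i + b i \<bullet> y)"
      by (simp add: inner_add_right algebra_simps)
  qed fact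
qed auto

text \<open>If no bound \<open>B\<close> worked, slopes of norm above \<open>k\<close> with bounded
  quotients would contradict (EX). The lemma serves twice: for finiteness of the supremum and for
  boundedness of nearly optimal slopes.\<close>

lemma steep_minorants_low:
  fixes f :: "'a::euclidean_space \<Rightarrow> real" and G :: "'a \<Rightarrow> 'a set"
  assumes EX: "\<And>y y'. \<lbrakk>\<And>k::nat. y k \<in> E; \<And>k. y' k \<in> G (y k); filterlim (\<lambda>k. norm (y' k)) at_top sequentially\<rbrakk>
      \<Longrightarrow> filterlim (\<lambda>k. (y k \<bullet> y' k - f (y k)) / norm (y' k)) at_top sequentially"
  obtains B where "\<And>y y' z. \<lbrakk>y \<in> E; y' \<in> G y; norm y' > B; norm z \<le> r\<rbrakk>
      \<Longrightarrow> f y + y' \<bullet> (z - y) \<le> - norm y'"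
proof -
  \<comment> \<open>Of the factor \<open>r + 1\<close>, the part \<open>r\<close> pays for
    \<open>y' \<bullet> z\<close> on the ball of radius \<open>r\<close>, and 1 leaves the claimed
    \<open>- norm y'\<close>. \<open>B \<ge> 0\<close> makes the denominator positive.\<close>
  have "\<exists>B\<ge>0. \<forall>y\<in>E. \<forall>y'\<in>G y. norm y' > B \<longrightarrow> r + 1 \<le> (y \<bullet> y' - f y) / norm y'"
  proof (rule ccontr)
    assume "\<not> ?thesis"
    then have "\<forall>k::nat. \<exists>y y'. y \<in> E \<and> y' \<in> G y \<and> norm y' > real k \<and> (y \<bullet> y' - f y) / norm y' < r + 1"
      by (metis not_le of_nat_0_le_iff)
    then obtain y y' where y: "\<And>k. y k \<in> E" "\<And>k. y' k \<in> G (y k)" "\<And>k::nat. norm (y' k) > real k"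
      and lt: "\<And>k. (y k \<bullet> y' k - f (y k)) / norm (y' k) < r + 1"
      by metis
    have "filterlim (\<lambda>k. norm (y' k)) at_top sequentially"
      by (rule filterlim_at_top_mono[OF filterlim_real_sequentially]) (use y(3) in \<open>auto intro!: always_eventually less_imp_le\<close>)
    then have "filterlim (\<lambda>k. (y k \<bullet> y' k - f (y k)) / norm (y' k)) at_top sequentially"
      using EX y by blast
    then have "\<forall>\<^sub>F k in sequentially. r + 1 \<le> (y k \<bullet> y' k - f (y k)) / norm (y' k)"
      unfolding filterlim_at_top by blast
    then show False
      using lt by (auto simp: eventually_sequentially not_le[symmetric])
  qed
  then obtain B where B: "B \<ge> 0"
    "\<And>y y'. \<lbrakk>y \<in> E; y' \<in> G y; norm y' > B\<rbrakk> \<Longrightarrow> r + 1 \<le> (y \<bullet> y' - f y) / norm y'"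
    by blast
  show thesis
  proof (rule that)
    fix y y' z :: 'a
    assume A: "y \<in> E" "y' \<in> G y" "norm y' > B" "norm z \<le> r"
    then have "norm y' > 0" using B(1) by linarith
    then have "(r + 1) * norm y' \<le> y \<bullet> y' - f y"
      using B(2)[OF A(1-3)] by (simp add: pos_le_divide_eq)
    moreover have "y' \<bullet> z \<le> norm y' * r"
      using norm_cauchy_schwarz[of y' z] A by (meson mult_left_mono norm_ge_zero order_trans)
    ultimately show "f y + y' \<bullet> (z - y) \<le> - norm y'"
      by (simp add: inner_diff_right inner_commute algebra_simps)
  qed
qed

lemma convex_extension_exists:
  fixes f :: "'a::euclidean_space \<Rightarrow> real" and G :: "'a \<Rightarrow> 'a set"
  assumes compact: "\<And>x. x \<in> E \<Longrightarrow> compact (G x)"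
    and convex: "\<And>x. x \<in> E \<Longrightarrow> convex (G x)"
    and ne: "\<And>x. x \<in> E \<Longrightarrow> G x \<noteq> {}"
    and C: "\<And>x y y'. \<lbrakk>x \<in> E; y \<in> E; y' \<in> G y\<rbrakk> \<Longrightarrow> f y + y' \<bullet> (x - y) \<le> f x"
    and EX: "\<And>y y'. \<lbrakk>\<And>k::nat. y k \<in> E; \<And>k. y' k \<in> G (y k); filterlim (\<lambda>k. norm (y' k)) at_top sequentially\<rbrakk>
      \<Longrightarrow> filterlim (\<lambda>k. (y k \<bullet> y' k - f (y k)) / norm (y' k)) at_top sequentially"
    and SCS: "\<And>x y y'. \<lbrakk>x \<in> E; \<And>k::nat. y k \<in> E; \<And>k. y' k \<in> G (y k); bounded (range y');
        (\<lambda>k. f x - f (y k) - y' k \<bullet> (x - y k)) \<longlonglongrightarrow> 0\<rbrakk>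
      \<Longrightarrow> \<exists>x'. (\<forall>k. x' k \<in> G x) \<and> (\<lambda>k. norm (x' k - y' k)) \<longlonglongrightarrow> 0"
  shows "\<exists>F. convex_on UNIV F \<and> (\<forall>x\<in>E. F x = f x \<and> subdifferential F x = G x)"
proof (cases "E = {}")
  \<comment> \<open>With no minorants the supremum is meaningless, so a constant is taken
    instead.\<close>
  case True
  then show ?thesis by (auto intro!: exI[of _ "\<lambda>_. 0"] simp: convex_on_const)
next
  case False
  define A where "A = Sigma E G"
  define h where "h = (\<lambda>p z. f (fst p) + snd p \<bullet> (z - fst p))"
  define m where "m = (\<lambda>z. SUP p\<in>A. h p z)"
  have "A \<noteq> {}" using False ne by (auto simp: A_def)
  obtain x0 where x0: "x0 \<in> E" using False by blast
  have bdd: "bdd_above ((\<lambda>p. h p z) ` A)" for z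
  proof -
    obtain B where B: "\<And>y y' w. \<lbrakk>y \<in> E; y' \<in> G y; norm y' > B; norm w \<le> norm z\<rbrakk>
        \<Longrightarrow> f y + y' \<bullet> (w - y) \<le> - norm y'"
      using steep_minorants_low[OF EX] by metis
    show ?thesis
    proof (rule bdd_aboveI2)
      fix p assume "p \<in> A"
      then obtain y y' where p: "p = (y, y')" "y \<in> E" "y' \<in> G y" by (auto simp: A_def)
      \<comment> \<open>Steep minorants are at most 0 at \<open>z\<close>. The others are at most
        \<open>f x0\<close> at \<open>x0\<close> by (C) and grow from there with slope at most
        \<open>B\<close>.\<close>
      show "h p z \<le> max 0 (f x0 + B * norm (z - x0))"
      proof (cases "norm y' > B")
        case True
        then have "h p z \<le> - norm y'" using B p by (simp add: h_def)
        then show ?thesis by (smt (verit) norm_ge_zero)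
      next
        case False
        have "h p z = f y + y' \<bullet> (x0 - y) + y' \<bullet> (z - x0)"
          by (simp add: p h_def inner_diff_right)
        moreover have "y' \<bullet> (z - x0) \<le> B * norm (z - x0)"
          using norm_cauchy_schwarz[of y' "z - x0"] False
          by (smt (verit) mult_right_mono norm_ge_zero)
        ultimately show ?thesis using C[OF x0 p(2,3)] by simp
      qed
    qed
  qed
  have le_m: "f y + y' \<bullet> (z - y) \<le> m z" if "y \<in> E" "y' \<in> G y" for y y' z
    unfolding m_def using that bdd
    by (intro cSUP_upper2[of _ _ "(y, y')"]) (auto simp: A_def h_def)
  have m_eq: "m x = f x" if x: "x \<in> E" for x
  proof (rule antisym)
    show "m x \<le> f x"
      unfolding m_def using \<open>A \<noteq> {}\<close> C[OF x] by (intro cSUP_least) (auto simp: A_def h_def)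
    obtain x' where "x' \<in> G x" using ne[OF x] by blast
    then show "f x \<le> m x" using le_m[OF x, of x' x] by simp
  qed
  have "convex_on UNIV (\<lambda>z. SUP p\<in>A. (f (fst p) - snd p \<bullet> fst p) + snd p \<bullet> z)"
    using \<open>A \<noteq> {}\<close>
    by (rule convex_on_SUP_affine) (use bdd in \<open>simp add: h_def inner_diff_right algebra_simps\<close>)
  then have "convex_on UNIV m"
    by (simp add: m_def h_def inner_diff_right algebra_simps)
  moreover have "subdifferential m x = G x" if x: "x \<in> E" for x
  proof
    show "G x \<subseteq> subdifferential m x"
      using le_m[OF x] m_eq[OF x] by (auto simp: subdifferential_def)
    show "subdifferential m x \<subseteq> G x"
    proof
      fix \<xi> assume \<xi>: "\<xi> \<in> subdifferential m x"
      show "\<xi> \<in> G x"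
      proof (rule ccontr)
        assume "\<xi> \<notin> G x"
        then obtain u b where u: "u \<bullet> \<xi> < b" "\<And>w. w \<in> G x \<Longrightarrow> b < u \<bullet> w"
          using separating_hyperplane_closed_point[OF convex[OF x] compact_imp_closed[OF compact[OF x]]]
          by metis
        \<comment> \<open>In direction \<open>v\<close>, every element of \<open>G x\<close> lies
          below \<open>\<xi>\<close> by more than \<open>d\<close>.\<close>
        define v d where "v = - u" and "d = b - u \<bullet> \<xi>"
        have d: "d > 0" "\<And>w. w \<in> G x \<Longrightarrow> w \<bullet> v + d < \<xi> \<bullet> v"
          using u by (auto simp: v_def d_def inner_commute)
        define t :: "nat \<Rightarrow> real" where "t = (\<lambda>k. 1 / real (Suc k))"
        have t: "t k > 0" "t k \<le> 1" for k by (auto simp: t_def)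
        have "t \<longlonglongrightarrow> 0" unfolding t_def by (rule LIMSEQ_Suc[OF lim_1_over_n])
        \<comment> \<open>The tolerance is proportional to \<open>t k\<close>, so that after
          division by \<open>t k\<close> only half of the gap \<open>d\<close> is lost.\<close>
        have "\<exists>p\<in>A. m (x + t k *\<^sub>R v) - t k * (d/2) < h p (x + t k *\<^sub>R v)" for k
        proof -
          have "m (x + t k *\<^sub>R v) - t k * (d/2) < m (x + t k *\<^sub>R v)"
            using d t by simp
          then show ?thesis
            unfolding m_def using less_cSUP_iff[OF \<open>A \<noteq> {}\<close> bdd] by blast
        qed
        then obtain p where p: "\<And>k. p k \<in> A"
            "\<And>k. m (x + t k *\<^sub>R v) - t k * (d/2) < h (p k) (x + t k *\<^sub>R v)"
          by metis
        define y y' where "y = (\<lambda>k. fst (p k))" and "y' = (\<lambda>k. snd (p k))"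
        have y: "y k \<in> E" "y' k \<in> G (y k)" for k
          using p(1)[of k] by (auto simp: A_def y_def y'_def)
        have near: "f x + t k * (\<xi> \<bullet> v) - t k * (d/2) \<le> f (y k) + y' k \<bullet> (x + t k *\<^sub>R v - y k)" for k
        proof -
          have "m x + \<xi> \<bullet> (x + t k *\<^sub>R v - x) \<le> m (x + t k *\<^sub>R v)"
            using \<xi> unfolding subdifferential_def by blast
          then show ?thesis
            using p(2)[of k] m_eq[OF x] by (simp add: h_def y_def y'_def)
        qed
        \<comment> \<open>This is the defect in (SCS), nonnegative by (C). Its upper bound from
          \<open>near\<close> is used twice: its sign bounds the slope along \<open>v\<close> from
          below, and its factor \<open>t k\<close> sends \<open>e\<close> to 0 once
          \<open>y'\<close> is bounded.\<close>
        define e where "e = (\<lambda>k. f x - f (y k) - y' k \<bullet> (x - y k))"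
        have e: "0 \<le> e k" "e k \<le> t k * (y' k \<bullet> v - \<xi> \<bullet> v + d/2)" for k
          using C[OF x y, of k] near[of k]
          by (auto simp: e_def inner_diff_right inner_add_right algebra_simps)
        have slope: "\<xi> \<bullet> v - d/2 \<le> y' k \<bullet> v" for k
        proof -
          have "0 \<le> t k * (y' k \<bullet> v - \<xi> \<bullet> v + d/2)" using e[of k] by linarith
          then show ?thesis using t(1)[of k] by (simp add: zero_le_mult_iff)
        qed
        obtain B where B: "\<And>y y' z. \<lbrakk>y \<in> E; y' \<in> G y; norm y' > B; norm z \<le> norm x + norm v\<rbrakk>
            \<Longrightarrow> f y + y' \<bullet> (z - y) \<le> - norm y'"
          using steep_minorants_low[OF EX] by metis
        \<comment> \<open>A slope steeper than \<open>B\<close> has minorant value at most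
          \<open>- norm (y' k)\<close> at \<open>x + t k *\<^sub>R v\<close>, while
          \<open>near\<close> bounds that value below; the second entry is the resulting bound on
          the norm.\<close>
        define K where "K = max B (\<bar>f x\<bar> + \<bar>\<xi> \<bullet> v\<bar> + d)"
        have K: "norm (y' k) \<le> K" for k
        proof (cases "norm (y' k) > B")
          case True
          have "norm (t k *\<^sub>R v) \<le> norm v"
            using t[of k] by (simp add: mult_left_le_one_le)
          then have "norm (x + t k *\<^sub>R v) \<le> norm x + norm v"
            using norm_triangle_ineq[of x "t k *\<^sub>R v"] by linarith
          then have "f x + t k * (\<xi> \<bullet> v) - t k * (d/2) \<le> - norm (y' k)"
            using B[OF y True] near[of k] by fastforce
          moreover have "\<bar>t k * (\<xi> \<bullet> v)\<bar> \<le> \<bar>\<xi> \<bullet> v\<bar>"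
            using t[of k] by (simp add: abs_mult mult_left_le_one_le)
          moreover have "t k * (d/2) \<le> d"
            using t[of k] d mult_left_le_one_le[of "d/2" "t k"] by simp
          ultimately show ?thesis unfolding K_def by linarith
        qed (simp add: K_def)
        then have "bounded (range y')"
          unfolding bounded_iff by blast
        moreover have "e \<longlonglongrightarrow> 0"
        proof (rule tendsto_sandwich[where f = "\<lambda>_. 0"])
          have "y' k \<bullet> v \<le> K * norm v" for k
            using norm_cauchy_schwarz[of "y' k" v] K[of k] mult_right_mono[OF K[of k] norm_ge_zero[of v]]
            by linarith
          then have "t k * (y' k \<bullet> v - \<xi> \<bullet> v + d/2) \<le> t k * (K * norm v - \<xi> \<bullet> v + d/2)" for k
            using t(1)[of k] by (intro mult_left_mono) (auto intro: less_imp_le)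
          then show "\<forall>\<^sub>F k in sequentially. e k \<le> t k * (K * norm v - \<xi> \<bullet> v + d/2)"
            using e(2) by (meson always_eventually order_trans)
          show "(\<lambda>k. t k * (K * norm v - \<xi> \<bullet> v + d/2)) \<longlonglongrightarrow> 0"
            using \<open>t \<longlonglongrightarrow> 0\<close> by (rule tendsto_mult_left_zero)
        qed (use e(1) in auto)
        ultimately obtain x' where x': "\<And>k. x' k \<in> G x" "(\<lambda>k. norm (x' k - y' k)) \<longlonglongrightarrow> 0"
          using SCS[of x y y'] x y unfolding e_def by blast
        have "(\<lambda>k. norm (x' k - y' k) * norm v) \<longlonglongrightarrow> 0"
          using x'(2) by (rule tendsto_mult_left_zero)
        \<comment> \<open>Along \<open>v\<close>, \<open>x' k\<close> is more than \<open>d\<close>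
          below \<open>\<xi>\<close>, but \<open>y' k\<close> at most \<open>d/2\<close> below, so
          the two sequences cannot approach each other.\<close>
        moreover have "d/2 \<le> norm (x' k - y' k) * norm v" for k
          using slope[of k] d(2)[OF x'(1)[of k]] norm_cauchy_schwarz[of "y' k - x' k" v]
          by (simp add: inner_diff_left norm_minus_commute)
        ultimately have "d/2 \<le> 0"
          by (intro LIMSEQ_le_const) auto
        then show False using d by simp
      qed
    qed
  qed
  ultimately show ?thesis using m_eq by blast
qed

section \<open>The equivalence, assembled from the two directions\<close>

theorem theorem1p1:
  fixes E :: "(real ^ 'n) set"
    and f :: "real ^ 'n \<Rightarrow> real"
    and G :: "real ^ 'n \<Rightarrow> (real ^ 'n) set"
  assumes "\<And>x. x \<in> E \<Longrightarrow> compact (G x)"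
    and "\<And>x. x \<in> E \<Longrightarrow> convex (G x)"
    and "\<And>x. x \<in> E \<Longrightarrow> G x \<noteq> {}"
  shows "(\<exists>F :: real ^ 'n \<Rightarrow> real. convex_on UNIV F \<and>
            (\<forall>x\<in>E. F x = f x \<and> subdifferential F x = G x))
    \<longleftrightarrow>
      (\<forall>x\<in>E. \<forall>y\<in>E. \<forall>y'\<in>G y. f x \<ge> f y + y' \<bullet> (x - y))
    \<and> (\<forall>(y :: nat \<Rightarrow> real ^ 'n) (y' :: nat \<Rightarrow> real ^ 'n).
          (\<forall>k. y k \<in> E) \<and> (\<forall>k. y' k \<in> G (y k)) \<and>
          filterlim (\<lambda>k. norm (y' k)) at_top sequentially \<longrightarrow>
          filterlim (\<lambda>k. (y k \<bullet> y' k - f (y k)) / norm (y' k)) at_top sequentially)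
    \<and> (\<forall>x\<in>E. \<forall>(y :: nat \<Rightarrow> real ^ 'n) (y' :: nat \<Rightarrow> real ^ 'n).
          (\<forall>k. y k \<in> E) \<and> (\<forall>k. y' k \<in> G (y k)) \<and> bounded (range y') \<and>
          (\<lambda>k. f x - f (y k) - y' k \<bullet> (x - y k)) \<longlonglongrightarrow> 0 \<longrightarrow>
          (\<exists>x' :: nat \<Rightarrow> real ^ 'n. (\<forall>k. x' k \<in> G x) \<and>
             (\<lambda>k. norm (x' k - y' k)) \<longlonglongrightarrow> 0))" (is "_ \<longleftrightarrow> ?C \<and> ?EX \<and> ?SCS")
proof
  assume "\<exists>F :: real ^ 'n \<Rightarrow> real. convex_on UNIV F \<and> (\<forall>x\<in>E. F x = f x \<and> subdifferential F x = G x)"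
  then obtain F :: "real ^ 'n \<Rightarrow> real" where F: "convex_on UNIV F"
    and f: "\<And>x. x \<in> E \<Longrightarrow> f x = F x" and G: "\<And>x. x \<in> E \<Longrightarrow> G x = subdifferential F x"
    by metis
  have sub: "F y + y' \<bullet> (z - y) \<le> F z" if "y \<in> E" "y' \<in> G y" for y y' z
    using that G by (simp add: subdifferential_def)
  show "?C \<and> ?EX \<and> ?SCS"
  proof (intro conjI)
    show ?C using sub f by simp
    show ?EX
    proof (intro allI impI, elim conjE)
      fix y y' :: "nat \<Rightarrow> real ^ 'n"
      assume "\<forall>k. y k \<in> E" "\<forall>k. y' k \<in> G (y k)"
        and lim: "filterlim (\<lambda>k. norm (y' k)) at_top sequentially"
      then have "y' k \<in> subdifferential F (y k)" "f (y k) = F (y k)" for k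
        using f G by auto
      then show "filterlim (\<lambda>k. (y k \<bullet> y' k - f (y k)) / norm (y' k)) at_top sequentially"
        using conjugate_superlinear_along_subgradients[OF F _ lim, of y] by simp
    qed
    show ?SCS
    proof (intro ballI allI impI, elim conjE)
      fix x and y y' :: "nat \<Rightarrow> real ^ 'n"
      let ?e = "\<lambda>k. f x - f (y k) - y' k \<bullet> (x - y k)"
      assume x: "x \<in> E" and y: "\<forall>k. y k \<in> E" "\<forall>k. y' k \<in> G (y k)"
        and bdd: "bounded (range y')" and e: "?e \<longlonglongrightarrow> 0"
      \<comment> \<open>The minorant based at \<open>y k\<close> is rebased at \<open>x\<close>: its
        gap to \<open>F\<close> there is exactly \<open>?e k\<close>, so \<open>y' k\<close> is an
        approximate subgradient at \<open>x\<close>.\<close>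
      have "F z \<ge> F x + y' k \<bullet> (z - x) - ?e k" for k z
        using sub[of "y k" "y' k" z] x y f by (simp add: inner_diff_right)
      then have lim: "(\<lambda>k. infdist (y' k) (G x)) \<longlonglongrightarrow> 0"
        using approximate_subgradients_near_subdifferential[of y' F x ?e] G[OF x] bdd e by simp
      \<comment> \<open>Nearest points of \<open>G x\<close> form the sequence that (SCS) asks
        for.\<close>
      have "\<exists>w\<in>G x. infdist (y' k) (G x) = dist (y' k) w" for k
        using infdist_attains_inf[OF compact_imp_closed[OF assms(1)[OF x]] assms(3)[OF x]] by metis
      then obtain x' where "\<And>k. x' k \<in> G x" "\<And>k. infdist (y' k) (G x) = dist (y' k) (x' k)"
        by metis
      then show "\<exists>x'. (\<forall>k. x' k \<in> G x) \<and> (\<lambda>k. norm (x' k - y' k)) \<longlonglongrightarrow> 0"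
        using lim by (intro exI[of _ x']) (simp add: dist_norm norm_minus_commute)
    qed
  qed
next
  assume "?C \<and> ?EX \<and> ?SCS"
  then have C: ?C and EX: ?EX and SCS: ?SCS by blast+
  show "\<exists>F :: real ^ 'n \<Rightarrow> real. convex_on UNIV F \<and> (\<forall>x\<in>E. F x = f x \<and> subdifferential F x = G x)"
  proof (rule convex_extension_exists[OF assms])
    show "f y + y' \<bullet> (x - y) \<le> f x" if "x \<in> E" "y \<in> E" "y' \<in> G y" for x y y'
      using C that by blast
  qed (use EX SCS in blast)+
qed

end
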